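(* Let $f:\mathbb{C}\to \mathrm{GL}(n,\mathbb{C})$ be holomorphic on all of $\mathbb{C}$ (i.e. $f\in\mathcal{L}_+(\mathrm{GL}(n,\mathbb{C}))$), let $\alpha\in\mathbb{C}$, and let $N:\mathbb{C}^n\to\mathbb{C}^n$ be linear with $N^2=0$. Let $f_1:=\left.\frac{d}{d\lambda}\right|_{\lambda=\alpha}f(\lambda)f(\alpha)^{-1}\in\mathfrak{gl}(n,\mathbb{C})$, and assume that $\mathrm{Id}+Nf_1$ is invertible. Define $$\tilde N:=f(\alpha)^{-1}(\mathrm{Id}+Nf_1)^{-1}Nf(\alpha).$$ Then $\tilde N^2=0$ and $$m_{\alpha,1,N}*f=m_{\alpha,1,N}\,f\,m_{\alpha,1,\tilde N}^{-1}\in\mathcal{L}_+(\mathrm{GL}(n,\mathbb{C})).$$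
   Context: For $\alpha\in\mathbb{C}$ and a linear map $N$ on $\mathbb{C}^n$ with $N^2=0$, $m_{\alpha,1,N}(\lambda)=\mathrm{Id}+\frac{1}{\lambda-\alpha}N$. $\mathcal{L}_+(\mathrm{GL}(n,\mathbb{C}))$ is the group of holomorphic maps $\mathbb{C}\to\mathrm{GL}(n,\mathbb{C})$ (membership of the displayed loop in it means that it extends holomorphically over $\lambda=\alpha$ with values in $\mathrm{GL}(n,\mathbb{C})$). $\mathcal{L}_-(\mathrm{GL}(n,\mathbb{C}))$ is the group of meromorphic maps $g:\mathbb{CP}^1\to\mathrm{GL}(n,\mathbb{C})$ (matrices of rational functions, invertible away from finitely many points) with $g(\infty)=\mathrm{Id}$. Dressing action: for $g_\pm\in\mathcal{L}_\pm(\mathrm{GL}(n,\mathbb{C}))$ such that there exist $\hat g_\pm\in\mathcal{L}_\pm(\mathrm{GL}(n,\mathbb{C}))$ with $g_-g_+=\hat g_+\hat g_-$, one defines $g_-*g_+:=\hat g_+$. *)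

theory Defs
  imports "HOL-Complex_Analysis.Complex_Analysis"
begin

definition loop_plus :: "(complex \<Rightarrow> complex^'n^'n) set" where
  "loop_plus = {g. (\<forall>i j. (\<lambda>z. g z $ i $ j) holomorphic_on UNIV) \<and> (\<forall>z. invertible (g z))}"

text \<open>
  A meromorphic map on the Riemann sphere is represented by a function on the complex plane
  which agrees with it outside a finite set, so that its values at poles are irrelevant.
  Its value at infinity is the limit there.
\<close>

definition loop_minus :: "(complex \<Rightarrow> complex^'n^'n) set" where
  "loop_minus = {g.
     (\<forall>i j. \<exists>p q :: complex poly. q \<noteq> 0 \<and>
        (\<forall>\<^sub>F z in cofinite. g z $ i $ j = poly p z / poly q z)) \<and>
     (\<forall>\<^sub>F z in cofinite. invertible (g z)) \<and>
     (g \<longlongrightarrow> mat 1) at_infinity}"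

definition dressing_factorization ::
  "(complex \<Rightarrow> complex^'n^'n) \<Rightarrow> (complex \<Rightarrow> complex^'n^'n) \<Rightarrow>
   (complex \<Rightarrow> complex^'n^'n) \<Rightarrow> (complex \<Rightarrow> complex^'n^'n) \<Rightarrow> bool" where
  "dressing_factorization gm gp hp hm \<longleftrightarrow>
     gm \<in> loop_minus \<and> gp \<in> loop_plus \<and> hp \<in> loop_plus \<and> hm \<in> loop_minus \<and>
     (\<forall>\<^sub>F z in cofinite. gm z ** gp z = hp z ** hm z)"

definition dressable ::
  "(complex \<Rightarrow> complex^'n^'n) \<Rightarrow> (complex \<Rightarrow> complex^'n^'n) \<Rightarrow> bool" where
  "dressable gm gp \<longleftrightarrow> (\<exists>hp hm. dressing_factorization gm gp hp hm)"

text \<open>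
  The factor in \<^const>\<open>loop_plus\<close> is unique whenever a factorization exists, by Liouville's theorem.
  The value is meaningful only for dressable pairs.
\<close>

definition dressing ::
  "(complex \<Rightarrow> complex^'n^'n) \<Rightarrow> (complex \<Rightarrow> complex^'n^'n) \<Rightarrow> complex \<Rightarrow> complex^'n^'n" where
  "dressing gm gp = (THE hp. \<exists>hm. dressing_factorization gm gp hp hm)"

text \<open>
  Here \<^term>\<open>mat c\<close> is the scalar matrix, so \<^term>\<open>mat c ** N\<close> is the multiple of \<^term>\<open>N\<close> by
  \<^term>\<open>c\<close>. At the pole the value is the arbitrary \<^term>\<open>mat 1\<close>, as division by zero gives zero.
\<close>

definition simple_factor :: "complex \<Rightarrow> complex^'n^'n \<Rightarrow> complex \<Rightarrow> complex^'n^'n" where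
  "simple_factor \<alpha> N z = mat 1 + mat (1 / (z - \<alpha>)) ** N"

definition matrix_deriv :: "(complex \<Rightarrow> complex^'n^'n) \<Rightarrow> complex \<Rightarrow> complex^'n^'n" where
  "matrix_deriv g z = (\<chi> i j. deriv (\<lambda>w. g w $ i $ j) z)"

end

theory Submission imports Defs begin

section \<open>Matrix algebra\<close>

text \<open>Put w = z - \<alpha>, F = f f(\<alpha>)^-1 = 1 + w C + w^2 R with C = \<open>f1\<close>,
  and P = (1 + N C)^-1 N. Since \<open>N'\<close> = f(\<alpha>)^-1 P f(\<alpha>), the desired loop
  is (1 + N/w) F (1 - P/w) f(\<alpha>). Its only possible pole is at \<alpha>, where w^-2 has
  coefficient -N P and w^-1 has coefficient N - P - N C P. The second vanishes because (1 + N C) P =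
  N. As N^2 = 0, also N (1 + N C) = N, so N P = N (1 + N C) P = N^2 = 0, and P^2 = (1 + N C)^-1 N P
  = 0. Hence the loop extends holomorphically (\<open>simple_factor_pole_cancellation\<close>).

  The extension must also be invertible at \<alpha>. Off \<alpha>, the inverse (1 + P/w) F^-1 (1 -
  N/w) of the normalised loop has the same shape, with N and P exchanged and C replaced by -C, so it
  extends too; the product of the extensions is 1 at \<alpha> by continuity
  (\<open>simple_factor_dressing_normalised\<close>).

  The extension is the dressed loop because the entire factor of a factorization is unique: the
  quotient of two such factors is entire and tends to 1 at infinity, so it is 1 by Liouville
  (\<open>dressing_factorization_unique\<close>).\<close>

lemma matrix_mul_minus_left: "(- A) ** B = - (A ** (B :: 'a::ring_1^'n^'m))"
  by (simp add: vec_eq_iff matrix_matrix_mult_def sum_negf)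

lemma matrix_mul_minus_right: "A ** (- B) = - (A ** (B :: 'a::ring_1^'n^'m))"
  by (simp add: vec_eq_iff matrix_matrix_mult_def sum_negf)

lemma matrix_mul_diff_left: "(A - B) ** C = A ** C - B ** (C :: 'a::ring_1^'n^'m)"
  by (simp add: vec_eq_iff matrix_matrix_mult_def sum_subtractf left_diff_distrib)

lemma matrix_mul_add_left: "(A + B) ** C = A ** C + B ** (C :: 'a::ring_1^'n^'m)"
  by (simp add: vec_eq_iff matrix_matrix_mult_def sum.distrib distrib_right)

lemma matrix_mul_diff_right: "A ** (B - C) = A ** B - A ** (C :: 'a::ring_1^'n^'m)"
  by (simp add: vec_eq_iff matrix_matrix_mult_def sum_subtractf right_diff_distrib)

lemmas matrix_mul_distribs = matrix_add_ldistrib matrix_mul_add_left matrix_mul_diff_left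
  matrix_mul_diff_right matrix_mul_minus_left matrix_mul_minus_right

lemma matrix_mul_scale_left:
  "map_matrix ((*) c) A ** B = map_matrix ((*) c) (A ** (B :: 'a::comm_ring_1^'n^'m))"
  by (simp add: vec_eq_iff matrix_matrix_mult_def sum_distrib_left mult_ac)

lemma matrix_mul_scale_right:
  "A ** map_matrix ((*) c) B = map_matrix ((*) c) (A ** (B :: 'a::comm_ring_1^'n^'m))"
  by (simp add: vec_eq_iff matrix_matrix_mult_def sum_distrib_left mult_ac)

lemma mat_mul_eq_scale: "mat c ** A = map_matrix ((*) c) (A :: 'a::comm_ring_1^'n^'m)"
  by (simp add: vec_eq_iff matrix_matrix_mult_def mat_def if_distrib if_distribR
      sum.delta' cong: if_cong)

section \<open>Inverse matrices and Cramer's rule\<close>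

lemma
  assumes "invertible A"
  shows matrix_inv_right: "A ** matrix_inv A = mat 1"
    and matrix_inv_left: "matrix_inv A ** A = mat 1"
proof -
  have "A ** matrix_inv A = mat 1 \<and> matrix_inv A ** A = mat 1"
    using assms unfolding matrix_inv_def invertible_def by (rule someI_ex)
  then show "A ** matrix_inv A = mat 1" "matrix_inv A ** A = mat 1" by auto
qed

lemma matrix_inv_unique:
  assumes "A ** B = mat 1" "B ** A = mat 1"
  shows "matrix_inv A = B"
proof -
  have "matrix_inv A = matrix_inv A ** (A ** B)" by (simp add: assms)
  also have "\<dots> = B"
    using assms invertible_def matrix_inv_left by (metis matrix_mul_assoc matrix_mul_lid)
  finally show ?thesis .
qed

lemma invertible_matrix_inv: "invertible A \<Longrightarrow> invertible (matrix_inv A)"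
  using matrix_inv_left matrix_inv_right invertible_def by blast

text \<open>Cramer's rule for column j of the inverse. Entries become quotients of determinants,
  which gives both continuity and holomorphy of inversion.\<close>

lemma matrix_inv_nth:
  fixes A :: "'a::field^'n^'n"
  assumes "invertible A"
  shows "matrix_inv A $ i $ j =
    det (\<chi> k l. if l = i then (mat 1 :: 'a^'n^'n) $ k $ j else A $ k $ l) / det A"
proof -
  have "A *v column j (matrix_inv A) = column j (mat 1)"
    using matrix_inv_right[OF assms]
    by (simp add: vec_eq_iff column_def matrix_vector_mult_def matrix_matrix_mult_def)
  then have "column j (matrix_inv A) =
      (\<chi> i. det (\<chi> k l. if l = i then column j (mat 1) $ k else A $ k $ l) / det A)"
    using assms by (subst (asm) cramer) (auto simp: invertible_det_nz)
  then show ?thesis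
    by (simp add: vec_eq_iff column_def cong: if_cong)
qed

section \<open>Limits and holomorphy of matrix functions\<close>

lemma tendsto_matrixI:
  fixes A :: "'b \<Rightarrow> 'a::topological_space^'n^'m"
  assumes "\<And>i j. ((\<lambda>x. A x $ i $ j) \<longlongrightarrow> B $ i $ j) F"
  shows "(A \<longlongrightarrow> B) F"
  using assms by (intro vec_tendstoI)

lemma tendsto_matrix_mult:
  fixes A :: "'b \<Rightarrow> 'a::real_normed_algebra_1^'n^'m"
  assumes "(A \<longlongrightarrow> A') F" "(B \<longlongrightarrow> B') F"
  shows "((\<lambda>x. A x ** B x) \<longlongrightarrow> A' ** B') F"
  by (rule tendsto_matrixI)
    (auto simp: matrix_matrix_mult_def intro!: tendsto_intros assms)

lemma tendsto_det:
  fixes A :: "'b \<Rightarrow> 'a::real_normed_field^'n^'n"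
  assumes "\<And>i j. ((\<lambda>x. A x $ i $ j) \<longlongrightarrow> B $ i $ j) F"
  shows "((\<lambda>x. det (A x)) \<longlongrightarrow> det B) F"
  unfolding det_def by (intro tendsto_intros assms)

lemma tendsto_matrix_inv:
  fixes A :: "'b \<Rightarrow> 'a::real_normed_field^'n^'n"
  assumes A: "(A \<longlongrightarrow> B) F" and B: "invertible B"
  shows "((\<lambda>x. matrix_inv (A x)) \<longlongrightarrow> matrix_inv B) F"
proof (rule tendsto_matrixI)
  fix i j
  have entry: "((\<lambda>x. A x $ k $ l) \<longlongrightarrow> B $ k $ l) F" for k l
    by (intro tendsto_vec_nth A)
  have "det B \<noteq> 0" using B by (simp add: invertible_det_nz)
  moreover have det: "((\<lambda>x. det (A x)) \<longlongrightarrow> det B) F"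
    by (intro tendsto_det entry)
  \<comment> \<open>Cramer's formula needs an invertible matrix, which is guaranteed only once the
    determinant is close to its nonzero limit.\<close>
  ultimately have "eventually (\<lambda>x. invertible (A x)) F"
    by (simp add: invertible_det_nz tendsto_imp_eventually_ne)
  then have "eventually (\<lambda>x. det (\<chi> k l. if l = i then (mat 1 :: 'a^'n^'n) $ k $ j
      else A x $ k $ l) / det (A x) = matrix_inv (A x) $ i $ j) F"
    by eventually_elim (simp add: matrix_inv_nth)
  moreover have "((\<lambda>x. det (\<chi> k l. if l = i then (mat 1 :: 'a^'n^'n) $ k $ j
      else A x $ k $ l) / det (A x)) \<longlongrightarrow> matrix_inv B $ i $ j) F"
    unfolding matrix_inv_nth[OF B] using \<open>det B \<noteq> 0\<close>
    by (intro tendsto_divide det tendsto_det) (auto intro: entry)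
  ultimately show "((\<lambda>x. matrix_inv (A x) $ i $ j) \<longlongrightarrow> matrix_inv B $ i $ j) F"
    by (rule Lim_transform_eventually[rotated])
qed

section \<open>Entire matrix functions and the group \<open>loop_plus\<close>\<close>

abbreviation entire_matrix :: "(complex \<Rightarrow> complex^'n^'m) \<Rightarrow> bool" where
  "entire_matrix g \<equiv> (\<forall>i j. (\<lambda>z. g z $ i $ j) holomorphic_on UNIV)"

lemma entire_matrix_mult:
  "entire_matrix A \<Longrightarrow> entire_matrix B \<Longrightarrow> entire_matrix (\<lambda>z. A z ** B z)"
  by (auto simp: matrix_matrix_mult_def intro!: holomorphic_intros)

lemma holomorphic_on_det:
  fixes A :: "complex \<Rightarrow> complex^'n^'n"
  assumes "\<And>i j. (\<lambda>z. A z $ i $ j) holomorphic_on S"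
  shows "(\<lambda>z. det (A z)) holomorphic_on S"
  unfolding det_def by (intro holomorphic_intros assms)

lemma entire_matrix_inv:
  fixes A :: "complex \<Rightarrow> complex^'n^'n"
  assumes "entire_matrix A" "\<And>z. invertible (A z)"
  shows "entire_matrix (\<lambda>z. matrix_inv (A z))"
proof (intro allI)
  fix i j
  have "(\<lambda>z. if l = i then (mat 1 :: complex^'n^'n) $ k $ j else A z $ k $ l)
      holomorphic_on UNIV" for k l
    using assms(1) by (cases "l = i") auto
  then show "(\<lambda>z. matrix_inv (A z) $ i $ j) holomorphic_on UNIV"
    unfolding matrix_inv_nth[OF assms(2)] using assms
    by (intro holomorphic_on_divide holomorphic_on_det) (auto simp: invertible_det_nz)
qed

text \<open>Continuity fills in the missing point. This carries identities across \<alpha>, where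
  \<open>simple_factor\<close> has only a placeholder value.\<close>

lemma entire_matrix_eq_const:
  assumes "entire_matrix A" "\<And>z. z \<noteq> \<alpha> \<Longrightarrow> A z = C"
  shows "A z = C"
proof (cases "z = \<alpha>")
  case True
  have "A \<alpha> $ i $ j = C $ i $ j" for i j
  proof (rule tendsto_unique)
    have "isCont (\<lambda>z. A z $ i $ j) \<alpha>"
      using assms(1) continuous_on_eq_continuous_at holomorphic_on_imp_continuous_on
        open_UNIV by blast
    then show "((\<lambda>z. A z $ i $ j) \<longlongrightarrow> A \<alpha> $ i $ j) (at \<alpha>)"
      by (simp add: isCont_def)
    show "((\<lambda>z. A z $ i $ j) \<longlongrightarrow> C $ i $ j) (at \<alpha>)"
      by (rule tendsto_eventually) (auto simp: eventually_at_filter assms(2))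
  qed simp
  then show ?thesis by (simp add: vec_eq_iff True)
qed (simp add: assms)

lemma loop_plus_mult: "A \<in> loop_plus \<Longrightarrow> B \<in> loop_plus \<Longrightarrow> (\<lambda>z. A z ** B z) \<in> loop_plus"
  by (simp add: loop_plus_def entire_matrix_mult invertible_mult)

lemma loop_plus_inv: "A \<in> loop_plus \<Longrightarrow> (\<lambda>z. matrix_inv (A z)) \<in> loop_plus"
  by (simp add: loop_plus_def entire_matrix_inv invertible_matrix_inv)

lemma loop_plus_const: "invertible A \<Longrightarrow> (\<lambda>_. A) \<in> loop_plus"
  by (simp add: loop_plus_def)

text \<open>Forming the difference quotient at \<alpha> twice, with the derivative as value at
  \<alpha>, stays holomorphic by removal of singularities. The remainder is thus entire, not just a
  local power series.\<close>

lemma entire_taylor2: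
  fixes g :: "complex \<Rightarrow> complex"
  assumes "g holomorphic_on UNIV"
  shows "\<exists>r. r holomorphic_on UNIV \<and>
    (\<forall>z. g z = g \<alpha> + (z - \<alpha>) * deriv g \<alpha> + (z - \<alpha>)\<^sup>2 * r z)"
proof -
  define q where "q = (\<lambda>z. if z = \<alpha> then deriv g \<alpha> else (g z - g \<alpha>) / (z - \<alpha>))"
  define r where "r = (\<lambda>z. if z = \<alpha> then deriv q \<alpha> else (q z - q \<alpha>) / (z - \<alpha>))"
  have "q holomorphic_on UNIV"
    unfolding q_def by (rule pole_lemma_open[OF assms open_UNIV])
  then have "r holomorphic_on UNIV"
    unfolding r_def by (rule pole_lemma_open[OF _ open_UNIV])
  moreover have "g z = g \<alpha> + (z - \<alpha>) * deriv g \<alpha> + (z - \<alpha>)\<^sup>2 * r z" for z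
  proof (cases "z = \<alpha>")
    case False
    have "g z = g \<alpha> + (z - \<alpha>) * q z"
      using False by (simp add: q_def)
    also have "q z = deriv g \<alpha> + (z - \<alpha>) * r z"
      using False by (simp add: r_def) (simp add: q_def)
    finally show ?thesis
      by (simp only: power2_eq_square distrib_left mult.assoc add.assoc)
  qed simp
  ultimately show ?thesis by blast
qed

lemma entire_matrix_taylor2:
  assumes "entire_matrix A"
  shows "\<exists>R. entire_matrix R \<and> (\<forall>z. A z = A \<alpha> +
    map_matrix ((*) (z - \<alpha>)) (matrix_deriv A \<alpha>) + map_matrix ((*) ((z - \<alpha>)\<^sup>2)) (R z))"
proof -
  have "\<forall>i j. \<exists>r. r holomorphic_on UNIV \<and> (\<forall>z. A z $ i $ j = A \<alpha> $ i $ j +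
      (z - \<alpha>) * deriv (\<lambda>z. A z $ i $ j) \<alpha> + (z - \<alpha>)\<^sup>2 * r z)"
    using assms entire_taylor2 by blast
  then obtain r where r: "\<And>i j. r i j holomorphic_on UNIV"
    "\<And>i j z. A z $ i $ j = A \<alpha> $ i $ j +
      (z - \<alpha>) * deriv (\<lambda>z. A z $ i $ j) \<alpha> + (z - \<alpha>)\<^sup>2 * r i j z"
    by metis
  have "A z = A \<alpha> + map_matrix ((*) (z - \<alpha>)) (matrix_deriv A \<alpha>) +
      map_matrix ((*) ((z - \<alpha>)\<^sup>2)) (\<chi> i j. r i j z)" for z
    unfolding vec_eq_iff by (intro allI, subst r(2)) (simp add: matrix_deriv_def)
  moreover have "entire_matrix (\<lambda>z. \<chi> i j. r i j z)"
    using r(1) by simp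
  ultimately show ?thesis
    by (intro exI[of _ "\<lambda>z. \<chi> i j. r i j z"]) (rule conjI, assumption, rule allI)
qed

section \<open>Simple factors\<close>

lemma simple_factor_eq:
  "simple_factor \<alpha> N z = mat 1 + map_matrix ((*) (1 / (z - \<alpha>))) N"
  by (simp add: simple_factor_def mat_mul_eq_scale)

lemma simple_factor_mult:
  "simple_factor \<alpha> A z ** simple_factor \<alpha> B z =
    mat 1 + map_matrix ((*) (1 / (z - \<alpha>))) (A + B) + map_matrix ((*) (1 / (z - \<alpha>)\<^sup>2)) (A ** B)"
  unfolding simple_factor_eq
  by (simp add: matrix_mul_distribs matrix_mul_scale_left matrix_mul_scale_right)
    (simp add: vec_eq_iff power2_eq_square distrib_left)

text \<open>Also true at z = \<alpha>, where both factors are \<open>mat 1\<close> since division by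
  zero gives zero.\<close>

lemma simple_factor_mult_minus:
  assumes "N ** N = 0"
  shows "simple_factor \<alpha> N z ** simple_factor \<alpha> (- N) z = mat 1"
    and "simple_factor \<alpha> (- N) z ** simple_factor \<alpha> N z = mat 1"
  by (simp_all add: simple_factor_mult matrix_mul_distribs assms) (simp_all add: vec_eq_iff)

lemma invertible_simple_factor: "N ** N = 0 \<Longrightarrow> invertible (simple_factor \<alpha> N z)"
  using simple_factor_mult_minus invertible_def by blast

lemma matrix_inv_simple_factor:
  "N ** N = 0 \<Longrightarrow> matrix_inv (simple_factor \<alpha> N z) = simple_factor \<alpha> (- N) z"
  by (intro matrix_inv_unique simple_factor_mult_minus)

lemma simple_factor_loop_minus:
  assumes "N ** N = 0"
  shows "simple_factor \<alpha> N \<in> loop_minus"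
proof -
  have "\<exists>p q :: complex poly. q \<noteq> 0 \<and>
      (\<forall>\<^sub>F z in cofinite. simple_factor \<alpha> N z $ i $ j = poly p z / poly q z)" for i j
  proof (intro exI conjI)
    show "[:- \<alpha>, 1:] \<noteq> 0" by simp
    \<comment> \<open>The entry over the common denominator z - \<alpha>.\<close>
    have "simple_factor \<alpha> N z $ i $ j =
        poly (smult (mat 1 $ i $ j) [:- \<alpha>, 1:] + [:N $ i $ j:]) z / poly [:- \<alpha>, 1:] z"
      if "z \<noteq> \<alpha>" for z
      using that by (simp add: simple_factor_eq field_simps)
    then show "\<forall>\<^sub>F z in cofinite. simple_factor \<alpha> N z $ i $ j =
        poly (smult (mat 1 $ i $ j) [:- \<alpha>, 1:] + [:N $ i $ j:]) z / poly [:- \<alpha>, 1:] z"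
      unfolding eventually_cofinite by (auto intro: finite_subset[of _ "{\<alpha>}"])
  qed
  moreover have "(simple_factor \<alpha> N \<longlongrightarrow> mat 1) at_infinity"
  proof (rule tendsto_matrixI)
    have lim: "filterlim (\<lambda>z. z - \<alpha>) at_infinity at_infinity"
      using tendsto_add_filterlim_at_infinity'[OF filterlim_ident tendsto_const, of "- \<alpha>"]
      by simp
    fix i j
    have "((\<lambda>z. mat 1 $ i $ j + 1 / (z - \<alpha>) * N $ i $ j) \<longlongrightarrow> mat 1 $ i $ j + 0 * N $ i $ j)
        at_infinity"
      by (intro tendsto_intros tendsto_divide_0[OF tendsto_const] lim)
    then show "((\<lambda>z. simple_factor \<alpha> N z $ i $ j) \<longlongrightarrow> mat 1 $ i $ j) at_infinity"
      by (simp add: simple_factor_eq)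
  qed
  ultimately show ?thesis
    using assms by (simp add: loop_minus_def invertible_simple_factor)
qed

text \<open>The hypotheses are the vanishing of the coefficients of $w^{-2}$ and $w^{-1}$ in
  $(1 + A/w)(1 + wC + w^2 R)(1 - B/w)$, where $w = z - \alpha$.\<close>

lemma simple_factor_pole_cancellation:
  fixes A B C :: "complex^'n^'n"
  assumes "A ** B = 0" "A = B + A ** C ** B" and R: "entire_matrix R"
    and M: "\<And>z. M z = mat 1 + map_matrix ((*) (z - \<alpha>)) C + map_matrix ((*) ((z - \<alpha>)\<^sup>2)) (R z)"
  shows "\<exists>H. entire_matrix H \<and>
    (\<forall>z. z \<noteq> \<alpha> \<longrightarrow> H z = simple_factor \<alpha> A z ** M z ** simple_factor \<alpha> (- B) z)"
proof (intro exI conjI)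
  let ?w = "\<lambda>z. z - \<alpha>"
  \<comment> \<open>The product multiplied out with its w^-2 and w^-1 terms deleted.\<close>
  define H where "H = (\<lambda>z. M z + A ** C - C ** B - A ** R z ** B
    + map_matrix ((*) (?w z)) (A ** R z - R z ** B))"
  have const: "entire_matrix (\<lambda>_. X)" for X :: "complex^'n^'n"
    by simp
  note R' = R[rule_format]
    entire_matrix_mult[OF const R, rule_format]
    entire_matrix_mult[OF R const, rule_format]
    entire_matrix_mult[OF entire_matrix_mult[OF const R] const, rule_format]
  show "entire_matrix H"
    by (auto simp: H_def M intro!: holomorphic_intros R')
  show "\<forall>z. z \<noteq> \<alpha> \<longrightarrow> H z = simple_factor \<alpha> A z ** M z ** simple_factor \<alpha> (- B) z"
  proof (intro allI impI)
    fix z assume "z \<noteq> \<alpha>"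
    define w where "w = z - \<alpha>"
    have w: "w \<noteq> 0" using \<open>z \<noteq> \<alpha>\<close> by (simp add: w_def)
    \<comment> \<open>Entrywise form of the second hypothesis; rewriting with it cancels the w^-1
      terms.\<close>
    have B: "B $ i $ j = A $ i $ j - (A ** C ** B) $ i $ j" for i j
      using arg_cong[OF assms(2), of "\<lambda>X. X $ i $ j"] by simp
    show "H z = simple_factor \<alpha> A z ** M z ** simple_factor \<alpha> (- B) z"
      unfolding simple_factor_eq H_def M w_def[symmetric]
      by (simp add: matrix_mul_distribs matrix_mul_scale_left matrix_mul_scale_right assms(1),
          simp add: vec_eq_iff B power2_eq_square w, intro allI, simp add: w ring_distribs,
          simp add: w field_simps)
  qed
qed

section \<open>Uniqueness of the dressing action\<close>

text \<open>Finite sets are bounded, so identities off a finite set may be used in limits at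
  infinity.\<close>

lemma at_infinity_le_cofinite: "(at_infinity :: 'a::real_normed_vector filter) \<le> cofinite"
proof (rule filter_leI)
  fix P :: "'a \<Rightarrow> bool"
  assume "eventually P cofinite"
  then have "bounded {x. \<not> P x}"
    unfolding eventually_cofinite by (rule finite_imp_bounded)
  then obtain b where "\<And>x. \<not> P x \<Longrightarrow> norm x \<le> b"
    by (auto simp: bounded_iff)
  then have "\<forall>x. b + 1 \<le> norm x \<longrightarrow> P x" by fastforce
  then show "eventually P at_infinity" unfolding eventually_at_infinity by blast
qed

text \<open>Off a finite set, km hm^-1 = kp^-1 hp. The left side tends to 1 at infinity and the
  right side is entire, so Liouville applies to each entry.\<close>

lemma dressing_factorization_unique:
  assumes "dressing_factorization gm gp hp hm" "dressing_factorization gm gp kp km"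
  shows "hp = kp"
proof
  fix z
  have hp: "hp \<in> loop_plus" and kp: "kp \<in> loop_plus"
    and hm: "hm \<in> loop_minus" and km: "km \<in> loop_minus"
    and eq: "\<forall>\<^sub>F z in cofinite. gm z ** gp z = hp z ** hm z"
      "\<forall>\<^sub>F z in cofinite. gm z ** gp z = kp z ** km z"
    using assms by (auto simp: dressing_factorization_def)
  have "\<forall>\<^sub>F z in cofinite. invertible (hm z)"
    using hm by (simp add: loop_minus_def)
  with eq have "\<forall>\<^sub>F z in cofinite. km z ** matrix_inv (hm z) = matrix_inv (kp z) ** hp z"
  proof eventually_elim
    case (elim z)
    have "invertible (kp z)" using kp by (simp add: loop_plus_def)
    have "km z = matrix_inv (kp z) ** (kp z ** km z)"
      by (simp add: matrix_mul_assoc matrix_inv_left \<open>invertible (kp z)\<close>)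
    also have "\<dots> = matrix_inv (kp z) ** hp z ** hm z"
      using elim by (metis matrix_mul_assoc)
    finally have "km z ** matrix_inv (hm z) =
        matrix_inv (kp z) ** hp z ** (hm z ** matrix_inv (hm z))"
      by (simp add: matrix_mul_assoc)
    then show ?case by (simp add: matrix_inv_right elim)
  qed
  then have "\<forall>\<^sub>F z in at_infinity. km z ** matrix_inv (hm z) = matrix_inv (kp z) ** hp z"
    by (rule filter_leD[OF at_infinity_le_cofinite])
  moreover have "((\<lambda>z. km z ** matrix_inv (hm z)) \<longlongrightarrow> mat 1 ** matrix_inv (mat 1)) at_infinity"
    using hm km by (intro tendsto_matrix_mult tendsto_matrix_inv)
      (auto simp: loop_minus_def invertible_def)
  ultimately have lim: "((\<lambda>z. matrix_inv (kp z) ** hp z) \<longlongrightarrow> mat 1) at_infinity"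
    by (simp add: matrix_inv_unique Lim_transform_eventually)
  have "(\<lambda>z. matrix_inv (kp z) ** hp z) \<in> loop_plus"
    by (intro loop_plus_mult loop_plus_inv hp kp)
  then have "(matrix_inv (kp z) ** hp z) $ i $ j = mat 1 $ i $ j" for i j
    by (intro Liouville_weak[of "\<lambda>z. (matrix_inv (kp z) ** hp z) $ i $ j"] tendsto_vec_nth lim)
      (simp add: loop_plus_def)
  then have "matrix_inv (kp z) ** hp z = mat 1" by (simp add: vec_eq_iff)
  moreover have "kp z ** matrix_inv (kp z) = mat 1"
    using kp by (simp add: loop_plus_def matrix_inv_right)
  ultimately show "hp z = kp z"
    by (metis matrix_mul_assoc matrix_mul_lid matrix_mul_rid)
qed

lemma dressing_eqI: "dressing_factorization gm gp hp hm \<Longrightarrow> dressing gm gp = hp"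
  unfolding dressing_def using dressing_factorization_unique by blast

section \<open>Dressing by a simple factor\<close>

text \<open>Here \<open>F\<close> is normalised to be \<open>1\<close> at \<open>\<alpha>\<close>. The inverse of the dressed loop is the dressed
  inverse loop with the roles of the two simple factors interchanged, so both are entire by
  the same pole cancellation.\<close>

lemma simple_factor_dressing_normalised:
  fixes F :: "complex \<Rightarrow> complex^'n^'n"
  assumes F: "F \<in> loop_plus" and F\<alpha>: "F \<alpha> = mat 1" and N: "N ** N = 0"
    and inv: "invertible (mat 1 + N ** matrix_deriv F \<alpha>)"
    and P: "P = matrix_inv (mat 1 + N ** matrix_deriv F \<alpha>) ** N"
  shows "P ** P = 0"
    and "\<exists>H \<in> loop_plus. \<forall>z. z \<noteq> \<alpha> \<longrightarrow>
      H z = simple_factor \<alpha> N z ** F z ** simple_factor \<alpha> (- P) z"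
proof -
  define C where "C = matrix_deriv F \<alpha>"
  define K where "K = mat 1 + N ** C"
  have P': "P = matrix_inv K ** N" and K: "invertible K"
    using P inv by (simp_all add: K_def C_def)
  have KP: "K ** P = N"
    by (simp add: P' matrix_mul_assoc matrix_inv_right K)
  have "N ** K = N"
    by (simp add: K_def matrix_mul_distribs matrix_mul_assoc N)
  \<comment> \<open>N P = (N K) P = N (K P) = N N.\<close>
  then have NP: "N ** P = 0"
    by (metis KP N matrix_mul_assoc)
  have PN: "P ** N = 0"
    by (metis N P' matrix_mul_assoc times0_right)
  show "P ** P = 0"
    by (metis NP P' matrix_mul_assoc times0_right)
  have N_eq: "N = P + N ** C ** P"
    using KP by (simp add: K_def matrix_mul_distribs)
  \<comment> \<open>The bracket is just N; distributing K^-1 over it gives the w^-1 condition for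
    the inverse loop.\<close>
  have "P = matrix_inv K ** (K ** N - N ** C ** N)"
    by (simp add: P' K_def matrix_mul_distribs)
  also have "\<dots> = N - P ** C ** N"
    by (simp add: matrix_mul_distribs matrix_mul_assoc matrix_inv_left K P')
  finally have P_eq: "P = N + P ** (- C) ** N"
    by (simp add: matrix_mul_distribs)
  have Fent: "entire_matrix F" and Finv: "\<And>z. invertible (F z)"
    using F by (auto simp: loop_plus_def)
  obtain R where R: "entire_matrix R" and FR: "\<And>z. F z = mat 1 +
      map_matrix ((*) (z - \<alpha>)) C + map_matrix ((*) ((z - \<alpha>)\<^sup>2)) (R z)"
    using entire_matrix_taylor2[OF Fent, of \<alpha>] F\<alpha> unfolding C_def by auto
  define G where "G = (\<lambda>z. matrix_inv (F z))"
  have G: "entire_matrix G" unfolding G_def by (intro entire_matrix_inv Fent Finv)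
  have GF: "G z ** F z = mat 1" "F z ** G z = mat 1" for z
    by (simp_all add: G_def matrix_inv_left matrix_inv_right Finv)
  \<comment> \<open>Found from F (1 - w C) = 1 - w^2 (C^2 - R + w R C) by multiplying with G = F^-1
    on the left. This expands G to second order without differentiating an inverse.\<close>
  define S where "S = (\<lambda>z. G z ** (C ** C - R z + map_matrix ((*) (z - \<alpha>)) (R z ** C)))"
  have S: "entire_matrix S"
    unfolding S_def using entire_matrix_mult[OF R, of "\<lambda>_. C"] R
    by (intro entire_matrix_mult G) (auto intro!: holomorphic_intros)
  have GS: "G z = mat 1 + map_matrix ((*) (z - \<alpha>)) (- C) +
      map_matrix ((*) ((z - \<alpha>)\<^sup>2)) (S z)" for z
  proof -
    have "F z ** (mat 1 + map_matrix ((*) (z - \<alpha>)) (- C)) + map_matrix ((*) ((z - \<alpha>)\<^sup>2))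
        (C ** C - R z + map_matrix ((*) (z - \<alpha>)) (R z ** C)) = mat 1"
      unfolding FR
      by (simp add: matrix_mul_distribs matrix_mul_scale_left matrix_mul_scale_right)
        (simp add: vec_eq_iff power2_eq_square algebra_simps)
    then have "G z ** (F z ** (mat 1 + map_matrix ((*) (z - \<alpha>)) (- C)) +
        map_matrix ((*) ((z - \<alpha>)\<^sup>2))
        (C ** C - R z + map_matrix ((*) (z - \<alpha>)) (R z ** C))) = G z"
      by simp
    then show ?thesis
      by (simp add: S_def matrix_add_ldistrib[of "G z" "F z ** _"] matrix_mul_assoc GF
          matrix_mul_scale_right)
  qed
  obtain H where H: "entire_matrix H"
    "\<And>z. z \<noteq> \<alpha> \<Longrightarrow> H z = simple_factor \<alpha> N z ** F z ** simple_factor \<alpha> (- P) z"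
    using simple_factor_pole_cancellation[OF NP N_eq R FR] by blast
  obtain J where J: "entire_matrix J"
    "\<And>z. z \<noteq> \<alpha> \<Longrightarrow> J z = simple_factor \<alpha> P z ** G z ** simple_factor \<alpha> (- N) z"
    using simple_factor_pole_cancellation[OF PN P_eq S GS] by blast
  have "H z ** J z = mat 1" if "z \<noteq> \<alpha>" for z
  proof -
    have "H z ** J z = simple_factor \<alpha> N z ** (F z **
        (simple_factor \<alpha> (- P) z ** simple_factor \<alpha> P z) ** G z) ** simple_factor \<alpha> (- N) z"
      by (simp add: H J that matrix_mul_assoc)
    then show ?thesis
      by (simp add: simple_factor_mult_minus N \<open>P ** P = 0\<close> GF)
  qed
  then have "H z ** J z = mat 1" for z
    using entire_matrix_eq_const[OF entire_matrix_mult[OF H(1) J(1)]] by blast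
  \<comment> \<open>For square matrices the right inverse \<open>J z\<close> suffices.\<close>
  then have "H \<in> loop_plus"
    using H(1) invertible_right_inverse unfolding loop_plus_def by blast
  then show "\<exists>H \<in> loop_plus. \<forall>z. z \<noteq> \<alpha> \<longrightarrow>
      H z = simple_factor \<alpha> N z ** F z ** simple_factor \<alpha> (- P) z"
    using H(2) by blast
qed

text \<open>Conjugation is linear and fixes 1. This passes from P for the normalised loop to
  \<open>N'\<close> for f.\<close>

lemma simple_factor_conjugate:
  assumes "B ** A = mat 1"
  shows "simple_factor \<alpha> (B ** P ** A) z = B ** simple_factor \<alpha> P z ** A"
  by (simp add: simple_factor_eq matrix_mul_distribs matrix_mul_scale_left
      matrix_mul_scale_right assms)

text \<open>The product formula is asserted only off \<alpha>; membership of h in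
  \<open>loop_plus\<close> expresses its holomorphic, invertible extension there.\<close>

theorem proposition5p1:
  fixes f :: "complex \<Rightarrow> complex^'n^'n"
    and \<alpha> :: complex
    and N f1 N' :: "complex^'n^'n"
  assumes "f \<in> loop_plus"
    and "N ** N = 0"
    and "f1 = matrix_deriv (\<lambda>z. f z ** matrix_inv (f \<alpha>)) \<alpha>"
    and "invertible (mat 1 + N ** f1)"
    and "N' = matrix_inv (f \<alpha>) ** matrix_inv (mat 1 + N ** f1) ** N ** f \<alpha>"
  shows "N' ** N' = 0 \<and>
    dressable (simple_factor \<alpha> N) f \<and>
    (\<exists>h \<in> loop_plus.
       (\<forall>z. z \<noteq> \<alpha> \<longrightarrow> invertible (simple_factor \<alpha> N' z) \<and>
          h z = simple_factor \<alpha> N z ** f z ** matrix_inv (simple_factor \<alpha> N' z)) \<and>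
       dressing (simple_factor \<alpha> N) f = h)"
proof -
  define A where "A = f \<alpha>"
  define B where "B = matrix_inv A"
  \<comment> \<open>Normalising on the right gives F(\<alpha>) = 1 and makes \<open>f1\<close> the
    derivative of F at \<alpha>.\<close>
  define F where "F = (\<lambda>z. f z ** B)"
  define P where "P = matrix_inv (mat 1 + N ** f1) ** N"
  have A: "invertible A"
    using assms(1) by (simp add: A_def loop_plus_def)
  then have AB: "A ** B = mat 1" "B ** A = mat 1"
    by (simp_all add: B_def matrix_inv_left matrix_inv_right)
  have F: "F \<in> loop_plus"
    unfolding F_def B_def
    by (intro loop_plus_mult loop_plus_const invertible_matrix_inv assms(1) A)
  have F\<alpha>: "F \<alpha> = mat 1" using AB by (simp add: F_def A_def)
  have f1: "f1 = matrix_deriv F \<alpha>" using assms(3) by (simp add: F_def A_def B_def)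
  note normalised = simple_factor_dressing_normalised
    [OF F F\<alpha> assms(2) assms(4)[unfolded f1] P_def[unfolded f1]]
  have N': "N' = B ** P ** A"
    by (simp add: assms(5) P_def A_def B_def matrix_mul_assoc)
  have "N' ** N' = B ** P ** (A ** B) ** P ** A"
    by (simp add: N' matrix_mul_assoc)
  also have "\<dots> = B ** (P ** P) ** A"
    by (simp add: AB matrix_mul_assoc)
  finally have N'2: "N' ** N' = 0" using normalised(1) by simp
  obtain H where H: "H \<in> loop_plus"
    "\<And>z. z \<noteq> \<alpha> \<Longrightarrow> H z = simple_factor \<alpha> N z ** F z ** simple_factor \<alpha> (- P) z"
    using normalised(2) by blast
  \<comment> \<open>Right multiplication by A = f(\<alpha>) undoes the normalisation: f B (1 - P/w)
    A = f (1 - N'/w).\<close>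
  define h where "h = (\<lambda>z. H z ** A)"
  have h: "h \<in> loop_plus"
    unfolding h_def by (intro loop_plus_mult loop_plus_const H A)
  have h_eq: "h z = simple_factor \<alpha> N z ** f z ** matrix_inv (simple_factor \<alpha> N' z)"
    if "z \<noteq> \<alpha>" for z
  proof -
    have "- N' = B ** (- P) ** A" by (simp add: N' matrix_mul_distribs)
    then show ?thesis
      by (simp add: matrix_inv_simple_factor N'2 simple_factor_conjugate AB h_def H that F_def
          matrix_mul_assoc)
  qed
  have "simple_factor \<alpha> N z ** f z = h z ** simple_factor \<alpha> N' z" if "z \<noteq> \<alpha>" for z
  proof -
    have "matrix_inv (simple_factor \<alpha> N' z) ** simple_factor \<alpha> N' z = mat 1"
      by (simp add: matrix_inv_left invertible_simple_factor N'2)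
    then show ?thesis
      by (metis h_eq[OF that] matrix_mul_assoc matrix_mul_rid)
  qed
  then have "\<forall>\<^sub>F z in cofinite. simple_factor \<alpha> N z ** f z = h z ** simple_factor \<alpha> N' z"
    unfolding eventually_cofinite by (auto intro: finite_subset[of _ "{\<alpha>}"])
  then have "dressing_factorization (simple_factor \<alpha> N) f h (simple_factor \<alpha> N')"
    by (simp add: dressing_factorization_def simple_factor_loop_minus assms(1,2) N'2 h)
  then show ?thesis
    using N'2 h h_eq dressing_eqI invertible_simple_factor unfolding dressable_def by blast
qed

end
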